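(* Let $\xi\in\mathbb{R}$ be a failure threshold, let $n\ge 0$ and $N\ge 1$ be integers ($N$ is the sampling budget), let $\gamma\in(0,1)$, and set $\beta=\Phi^{-1}\left(1-\frac{\gamma}{N}\right)$, where $\Phi$ is the standard normal cumulative distribution function. Starting from the Gaussian process predictor $\hat h_n$ of the constraint function, suppose that design points $\mathbf{x}_{n+1},\ldots,\mathbf{x}_{n+N}$ are chosen sequentially so that, for each $i\in\{n+1,\ldots,n+N\}$, $\mathbf{x}_i$ is chosen on the basis of the data $\mathcal{D}_{i-1}$ and $\mathbf{x}_i\in S_{i-1}$, where $$S_{i-1}=\{\mathbf{x}\in\Omega:\ \hat\mu^h_{i-1}(\mathbf{x})+\beta\,\hat\sigma^h_{i-1}(\mathbf{x})<\xi\}$$ is the estimated safe region. Then the probability that at least one of the $N$ queried points is a failure is at most $\gamma$: $$\Pr\left(\bigcup_{i=n+1}^{n+N}\left\{\hat h(\mathbf{x}_i)\ge \xi\right\}\right)\le\gamma .$$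
   Context: $\Omega\subseteq\mathbb{R}^D$ is a compact connected design space. The unknown constraint function $h:\Omega\to\mathbb{R}$ is modelled by a Gaussian process with zero mean and a covariance kernel, and is observed with independent Gaussian noise. A system failure at $\mathbf{x}$ is the event that the constraint value at $\mathbf{x}$ is $\ge\xi$. $\mathcal{D}_m$ denotes the data consisting of the first $m$ design points and their observations. $\hat h_m$ is the Gaussian process predictor of $h$ based on $\mathcal{D}_m$, with predictive mean $\hat\mu^h_m(\mathbf{x})$ and predictive standard deviation $\hat\sigma^h_m(\mathbf{x})$. Probabilities are taken under the Gaussian process model: conditionally on $\mathcal{D}_{i-1}$ (and hence on the choice $\mathbf{x}_i\in S_{i-1}$), the constraint value $\hat h(\mathbf{x}_i)$ at the $i$-th queried point is distributed as $\mathcal{N}\left(\hat\mu^h_{i-1}(\mathbf{x}_i),\,\hat\sigma^h_{i-1}(\mathbf{x}_i)^2\right)$. *)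

theory Defs
  imports
    "HOL-Probability.Probability"
    "Jordan_Normal_Form.Gauss_Jordan_Elimination"
begin

definition std_normal_cdf :: "real \<Rightarrow> real" where
  "std_normal_cdf = cdf std_normal_distribution"

text \<open>The normal law with mean \<open>m\<close> and standard deviation \<open>s \<ge> 0\<close>. It is the point mass at \<open>m\<close>
  for \<open>s = 0\<close>, a case that \<^const>\<open>normal_density\<close> does not cover; a predictive standard deviation
  vanishes wherever the kernel is degenerate.\<close>

definition gaussian_measure :: "real \<Rightarrow> real \<Rightarrow> real measure" where
  "gaussian_measure m s =
     (if s = 0 then return borel m
      else density lborel (\<lambda>t. ennreal (normal_density m s t)))"

text \<open>A zero-mean Gaussian process on \<open>\<Omega>\<close>: finite-dimensional distributions are jointly Gaussian,
  that is, every finite linear combination of values is (possibly degenerate) normal.\<close>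

definition centred_gaussian_process ::
  "'s measure \<Rightarrow> 'x set \<Rightarrow> ('x \<Rightarrow> 'x \<Rightarrow> real) \<Rightarrow> ('x \<Rightarrow> 's \<Rightarrow> real) \<Rightarrow> bool" where
  "centred_gaussian_process M \<Omega> k h \<longleftrightarrow>
     (\<forall>x\<in>\<Omega>. h x \<in> borel_measurable M) \<and>
     (\<forall>J a. finite J \<longrightarrow> J \<subseteq> \<Omega> \<longrightarrow>
        (\<exists>m s. 0 \<le> s \<and> distr M borel (\<lambda>\<omega>. \<Sum>x\<in>J. a x * h x \<omega>) = gaussian_measure m s)) \<and>
     (\<forall>x\<in>\<Omega>. integral\<^sup>L M (h x) = 0) \<and>
     (\<forall>x\<in>\<Omega>. \<forall>x'\<in>\<Omega>. integral\<^sup>L M (\<lambda>\<omega>. h x \<omega> * h x' \<omega>) = k x x')"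

text \<open>Gaussian process regression on design points \<open>X 1, \<dots>, X m\<close> with observations
  \<open>Y 1, \<dots>, Y m\<close>, kernel \<open>k\<close> and noise standard deviations \<open>\<tau> 1, \<dots>, \<tau> m\<close>. Matrices and vectors are
  indexed from 0, hence the shifts. With \<open>K\<close> the noisy Gram matrix and \<open>c\<close> the vector of the
  \<open>k (X j) x\<close>, the predictive mean at \<open>x\<close> is \<open>c\<^sup>T K\<^sup>-\<^sup>1 Y\<close> and the predictive variance is
  \<open>k x x - c\<^sup>T K\<^sup>-\<^sup>1 c\<close>. For positive \<open>\<tau>\<close> and positive semidefinite \<open>k\<close> the matrix \<open>K\<close> is
  positive definite, so the inverse exists.\<close>

definition noisy_gram ::
  "('x \<Rightarrow> 'x \<Rightarrow> real) \<Rightarrow> (nat \<Rightarrow> real) \<Rightarrow> nat \<Rightarrow> (nat \<Rightarrow> 'x) \<Rightarrow> real mat" where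
  "noisy_gram k \<tau> m X =
     mat m m (\<lambda>(i, j). k (X (Suc i)) (X (Suc j)) + (if i = j then (\<tau> (Suc i))\<^sup>2 else 0))"

definition cross_cov ::
  "('x \<Rightarrow> 'x \<Rightarrow> real) \<Rightarrow> nat \<Rightarrow> (nat \<Rightarrow> 'x) \<Rightarrow> 'x \<Rightarrow> real Matrix.vec" where
  "cross_cov k m X x = Matrix.vec m (\<lambda>i. k (X (Suc i)) x)"

definition gp_mean ::
  "('x \<Rightarrow> 'x \<Rightarrow> real) \<Rightarrow> (nat \<Rightarrow> real) \<Rightarrow> nat \<Rightarrow> (nat \<Rightarrow> 'x) \<Rightarrow> (nat \<Rightarrow> real) \<Rightarrow> 'x \<Rightarrow> real" where
  "gp_mean k \<tau> m X Y x =
     scalar_prod (cross_cov k m X x)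
       (the (mat_inverse (noisy_gram k \<tau> m X)) *\<^sub>v Matrix.vec m (\<lambda>i. Y (Suc i)))"

definition gp_sd ::
  "('x \<Rightarrow> 'x \<Rightarrow> real) \<Rightarrow> (nat \<Rightarrow> real) \<Rightarrow> nat \<Rightarrow> (nat \<Rightarrow> 'x) \<Rightarrow> 'x \<Rightarrow> real" where
  "gp_sd k \<tau> m X x =
     sqrt (k x x - scalar_prod (cross_cov k m X x)
       (the (mat_inverse (noisy_gram k \<tau> m X)) *\<^sub>v cross_cov k m X x))"

definition safe_region ::
  "'x set \<Rightarrow> real \<Rightarrow> real \<Rightarrow> ('x \<Rightarrow> 'x \<Rightarrow> real) \<Rightarrow> (nat \<Rightarrow> real) \<Rightarrow>
     nat \<Rightarrow> (nat \<Rightarrow> 'x) \<Rightarrow> (nat \<Rightarrow> real) \<Rightarrow> 'x set" where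
  "safe_region \<Omega> \<xi> \<beta> k \<tau> m X Y = {x \<in> \<Omega>. gp_mean k \<tau> m X Y x + \<beta> * gp_sd k \<tau> m X x < \<xi>}"

text \<open>The \<open>\<sigma>\<close>-algebra generated by the first \<open>m\<close> design points and their observations.\<close>

definition data_algebra ::
  "'s measure \<Rightarrow> (nat \<Rightarrow> 's \<Rightarrow> 'x::topological_space) \<Rightarrow> (nat \<Rightarrow> 's \<Rightarrow> real) \<Rightarrow> nat \<Rightarrow> 's measure" where
  "data_algebra M x y m =
     vimage_algebra (space M) (\<lambda>\<omega>. \<lambda>j\<in>{1..m}. (x j \<omega>, y j \<omega>))
       (\<Pi>\<^sub>M j\<in>{1..m}. borel \<Otimes>\<^sub>M borel)"

definition conditionally_gaussian ::
  "'s measure \<Rightarrow> 's measure \<Rightarrow> ('s \<Rightarrow> real) \<Rightarrow> ('s \<Rightarrow> real) \<Rightarrow> ('s \<Rightarrow> real) \<Rightarrow> bool" where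
  "conditionally_gaussian M F Z \<mu> \<sigma> \<longleftrightarrow>
     (\<forall>B\<in>sets borel. AE \<omega> in M.
        real_cond_exp M F (indicator (Z -` B \<inter> space M)) \<omega>
          = measure (gaussian_measure (\<mu> \<omega>) (\<sigma> \<omega>)) B)"

text \<open>A Gaussian process \<open>h\<close> observed with independent Gaussian noise at the (possibly random) design
  points \<open>x 1, \<dots>, x T\<close>. Values at a random point are random variables only by assumption, as the
  sample paths of \<open>h\<close> need not be regular.\<close>

locale gp_observations = prob_space M
  for M :: "'s measure" +
  fixes T :: nat
    and \<Omega> :: "(real ^ 'd) set"
    and k :: "real ^ 'd \<Rightarrow> real ^ 'd \<Rightarrow> real"
    and h :: "real ^ 'd \<Rightarrow> 's \<Rightarrow> real"
    and \<tau> :: "nat \<Rightarrow> real"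
    and \<epsilon> :: "nat \<Rightarrow> 's \<Rightarrow> real"
    and x :: "nat \<Rightarrow> 's \<Rightarrow> real ^ 'd"
    and y :: "nat \<Rightarrow> 's \<Rightarrow> real"
  assumes compact_domain: "compact \<Omega>"
    and connected_domain: "connected \<Omega>"
    and process: "centred_gaussian_process M \<Omega> k h"
    and noise_sd_pos: "\<And>j. j \<in> {1..T} \<Longrightarrow> 0 < \<tau> j"
    and noise_law: "\<And>j. j \<in> {1..T} \<Longrightarrow> distr M borel (\<epsilon> j) = gaussian_measure 0 (\<tau> j)"
    and noise_indep: "indep_vars (\<lambda>_. borel) \<epsilon> {1..T}"
    and noise_process_indep:
      "indep_set
         (sets (vimage_algebra (space M) (\<lambda>\<omega>. \<lambda>p\<in>\<Omega>. h p \<omega>) (\<Pi>\<^sub>M p\<in>\<Omega>. borel)))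
         (sets (vimage_algebra (space M) (\<lambda>\<omega>. \<lambda>j\<in>{1..T}. \<epsilon> j \<omega>) (\<Pi>\<^sub>M j\<in>{1..T}. borel)))"
    and design_measurable: "\<And>j. j \<in> {1..T} \<Longrightarrow> x j \<in> borel_measurable M"
    and design_in_domain: "\<And>j \<omega>. j \<in> {1..T} \<Longrightarrow> \<omega> \<in> space M \<Longrightarrow> x j \<omega> \<in> \<Omega>"
    and value_measurable: "\<And>j. j \<in> {1..T} \<Longrightarrow> (\<lambda>\<omega>. h (x j \<omega>) \<omega>) \<in> borel_measurable M"
    and observation: "\<And>j \<omega>. j \<in> {1..T} \<Longrightarrow> \<omega> \<in> space M \<Longrightarrow> y j \<omega> = h (x j \<omega>) \<omega> + \<epsilon> j \<omega>"

end

theory Submission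
  imports Defs "Jordan_Normal_Form.Determinant"
begin

text \<open>Given the data, the value at a safe point is normal with mean below \<open>\<xi> - \<beta> \<sigma>\<close>, so it
  reaches \<open>\<xi>\<close> with conditional probability at most \<open>1 - \<Phi> \<beta> = \<gamma> / N\<close>. Integrating out the data
  and summing over the \<open>N\<close> queries gives the bound.\<close>

section \<open>Normal laws, degenerate ones included, and the standard normal quantile\<close>

lemma prob_space_gaussian_measure: "0 \<le> s \<Longrightarrow> prob_space (gaussian_measure m s)"
  by (auto simp: gaussian_measure_def intro!: prob_space_return prob_space_normal_density)

lemma sets_gaussian_measure [simp, measurable_cong]: "sets (gaussian_measure m s) = sets borel"
  by (simp add: gaussian_measure_def)

lemma space_gaussian_measure [simp]: "space (gaussian_measure m s) = UNIV"
  by (simp add: gaussian_measure_def)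

lemma integrable_gaussian_measure_square:
  assumes "0 \<le> s"
  shows "integrable (gaussian_measure m s) (\<lambda>t. t\<^sup>2)"
proof (cases "s = 0")
  case True
  interpret prob_space "return borel m" by (rule prob_space_return) simp
  have "integrable (return borel m) (\<lambda>t. t\<^sup>2)"
    by (rule integrable_const_bound[where B = "m\<^sup>2"]) (auto simp: AE_return)
  with True show ?thesis by (simp add: gaussian_measure_def)
next
  case False
  with assms have s: "0 < s" by simp
  \<comment> \<open>The available moments are centred, so \<open>t\<^sup>2\<close> is expanded
    around \<open>m\<close>.\<close>
  have "integrable lborel (\<lambda>t. normal_density m s t * (t - m)^2
          + 2 * m * (normal_density m s t * (t - m)^1) + m\<^sup>2 * (normal_density m s t * (t - m)^0))"
    by (intro Bochner_Integration.integrable_add integrable_mult_right integrable_normal_moment s)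
  also have "(\<lambda>t. normal_density m s t * (t - m)^2
          + 2 * m * (normal_density m s t * (t - m)^1) + m\<^sup>2 * (normal_density m s t * (t - m)^0))
        = (\<lambda>t. normal_density m s t * t\<^sup>2)"
    by (auto simp: power2_eq_square algebra_simps)
  finally show ?thesis
    using False by (simp add: gaussian_measure_def integrable_density)
qed

lemma distr_normal_standardize:
  assumes "0 < s"
  shows "distr (gaussian_measure m s) borel (\<lambda>t. (t - m) / s) = std_normal_distribution"
proof -
  interpret prob_space "gaussian_measure m s"
    using assms by (intro prob_space_gaussian_measure) simp
  have "distributed (gaussian_measure m s) lborel (\<lambda>t. t) (normal_density m s)"
    using assms by (auto simp: distributed_def gaussian_measure_def distr_id2)
  then have "distributed (gaussian_measure m s) lborel (\<lambda>t. (t - m) / s) std_normal_density"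
    by (rule normal_standard_normal_convert[OF assms, THEN iffD1])
  then have "distr (gaussian_measure m s) lborel (\<lambda>t. (t - m) / s) = std_normal_distribution"
    by (simp add: distributed_def)
  \<comment> \<open>\<open>distributed\<close> pushes forward to \<open>lborel\<close>;
    \<open>distr\<close> depends on its target only through the measurable sets, so
    \<open>borel\<close> gives the same measure.\<close>
  moreover have "distr (gaussian_measure m s) borel (\<lambda>t. (t - m) / s)
      = distr (gaussian_measure m s) lborel (\<lambda>t. (t - m) / s)"
    by (rule distr_cong) auto
  ultimately show ?thesis by simp
qed

text \<open>The threshold lies more than \<beta> standard deviations above the mean, so
  standardizing moves the tail into that of the standard normal law beyond \<beta>. For
  \<open>s = 0\<close> the point mass at \<open>m\<close> lies below \<xi>.\<close>

lemma gaussian_tail_le: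
  assumes "0 \<le> s" and "m + \<beta> * s < \<xi>"
  shows "measure (gaussian_measure m s) {\<xi>..} \<le> 1 - std_normal_cdf \<beta>"
proof (cases "s = 0")
  case True
  interpret real_distribution std_normal_distribution by (rule real_dist_normal_dist)
  show ?thesis
    using True assms cdf_bounded_prob[of \<beta>]
    by (simp add: gaussian_measure_def measure_return std_normal_cdf_def)
next
  case False
  with assms have s: "0 < s" by simp
  interpret real_distribution std_normal_distribution by (rule real_dist_normal_dist)
  interpret G: prob_space "gaussian_measure m s" by (rule prob_space_gaussian_measure) fact
  \<comment> \<open>The strict safety inequality yields an open half-line, the exact complement of
    \<open>{..\<beta>}\<close>; no continuity of the distribution function is needed here.\<close>
  have "{\<xi>..} \<subseteq> (\<lambda>t. (t - m) / s) -` {\<beta><..} \<inter> space (gaussian_measure m s)"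
    using assms s by (auto simp: field_simps)
  then have "measure (gaussian_measure m s) {\<xi>..}
      \<le> measure (gaussian_measure m s) ((\<lambda>t. (t - m) / s) -` {\<beta><..} \<inter> space (gaussian_measure m s))"
    by (intro G.finite_measure_mono) measurable
  also have "\<dots> = measure (distr (gaussian_measure m s) borel (\<lambda>t. (t - m) / s)) {\<beta><..}"
    by (rule measure_distr[symmetric]) auto
  also have "\<dots> = measure std_normal_distribution {\<beta><..}"
    by (simp only: distr_normal_standardize[OF s])
  also have "{\<beta><..} = space std_normal_distribution - {..\<beta>}"
    by auto
  also have "measure std_normal_distribution \<dots> = 1 - std_normal_cdf \<beta>"
    unfolding std_normal_cdf_def cdf_def by (rule prob_compl) simp
  finally show ?thesis .
qed

text \<open>\<open>inv_into\<close> inverts only on the range, so the point is that every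
  \<open>p\<close> strictly between 0 and 1 is attained: by the limits 0 and 1 and the intermediate
  value theorem.\<close>

lemma std_normal_cdf_inv_into:
  assumes "0 < p" "p < 1"
  shows "std_normal_cdf (inv_into UNIV std_normal_cdf p) = p"
proof (rule f_inv_into_f)
  interpret real_distribution std_normal_distribution by (rule real_dist_normal_dist)
  \<comment> \<open>Continuity of a distribution function at \<open>t\<close> means that
    \<open>t\<close> is not an atom.\<close>
  have "emeasure std_normal_distribution {t} = 0" for t
    by (subst emeasure_density) (auto simp: nn_integral_null_set)
  then have cont: "isCont std_normal_cdf t" for t
    unfolding std_normal_cdf_def isCont_cdf by (simp add: measure_def)
  have "\<forall>\<^sub>F t in at_bot. std_normal_cdf t < p"
    unfolding std_normal_cdf_def by (rule order_tendstoD[OF cdf_lim_at_bot]) fact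
  then obtain a where a: "\<And>t. t \<le> a \<Longrightarrow> std_normal_cdf t < p"
    by (auto simp: eventually_at_bot_linorder)
  have "\<forall>\<^sub>F t in at_top. p < std_normal_cdf t"
    unfolding std_normal_cdf_def by (rule order_tendstoD[OF cdf_lim_at_top_prob]) fact
  then obtain b where b: "\<And>t. b \<le> t \<Longrightarrow> p < std_normal_cdf t"
    by (auto simp: eventually_at_top_linorder)
  \<comment> \<open>\<open>min\<close> and \<open>max\<close> save comparing \<open>a\<close> with
    \<open>b\<close>.\<close>
  have "\<exists>t\<ge>min a b. t \<le> max a b \<and> std_normal_cdf t = p"
    using a[of "min a b"] b[of "max a b"] by (intro IVT) (auto simp: cont)
  then show "p \<in> range std_normal_cdf" by auto
qed

section \<open>Second moments of the process and positive semidefiniteness of the kernel\<close>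

text \<open>The covariance equation alone does not give this, since the integral of a non-integrable
  function is 0 by convention. Each value is normal, hence square integrable, and the product is
  dominated by the sum of the squares.\<close>

lemma centred_gaussian_process_integrable_mult:
  assumes "centred_gaussian_process M \<Omega> k h" "p \<in> \<Omega>" "q \<in> \<Omega>"
  shows "integrable M (\<lambda>\<omega>. h p \<omega> * h q \<omega>)"
proof -
  have meas: "h p \<in> borel_measurable M" if "p \<in> \<Omega>" for p
    using assms(1) that by (simp add: centred_gaussian_process_def)
  have sq: "integrable M (\<lambda>\<omega>. (h p \<omega>)\<^sup>2)" if p: "p \<in> \<Omega>" for p
  proof -
    have *: "\<And>J a. finite J \<Longrightarrow> J \<subseteq> \<Omega> \<Longrightarrow>
        \<exists>m s. 0 \<le> s \<and> distr M borel (\<lambda>\<omega>. \<Sum>x\<in>J. a x * h x \<omega>) = gaussian_measure m s"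
      using assms(1) unfolding centred_gaussian_process_def by blast
    \<comment> \<open>A one-point combination with coefficient 1 is the value itself.\<close>
    obtain m s where "0 \<le> s" "distr M borel (h p) = gaussian_measure m s"
      using *[of "{p}" "\<lambda>_. 1"] p by auto
    then have "integrable (distr M borel (h p)) (\<lambda>t. t\<^sup>2)"
      by (simp add: integrable_gaussian_measure_square)
    then show ?thesis
      using meas[OF p] by (simp add: integrable_distr_eq)
  qed
  show ?thesis
  proof (rule Bochner_Integration.integrable_bound)
    show "integrable M (\<lambda>\<omega>. (h p \<omega>)\<^sup>2 + (h q \<omega>)\<^sup>2)"
      using assms by (intro Bochner_Integration.integrable_add sq)
    show "(\<lambda>\<omega>. h p \<omega> * h q \<omega>) \<in> borel_measurable M"
      using assms by (intro borel_measurable_times meas)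
    have "\<bar>a * b\<bar> \<le> a\<^sup>2 + b\<^sup>2" for a b :: real
    proof -
      have "2 * (\<bar>a\<bar> * \<bar>b\<bar>) \<le> a\<^sup>2 + b\<^sup>2"
        using sum_squares_bound[of "\<bar>a\<bar>" "\<bar>b\<bar>"] by simp
      moreover have "0 \<le> \<bar>a\<bar> * \<bar>b\<bar>" by simp
      ultimately show ?thesis unfolding abs_mult by linarith
    qed
    then show "AE \<omega> in M. norm (h p \<omega> * h q \<omega>) \<le> norm ((h p \<omega>)\<^sup>2 + (h q \<omega>)\<^sup>2)"
      by (intro AE_I2) (metis abs_of_nonneg real_norm_def sum_power2_ge_zero)
  qed
qed

lemma centred_gaussian_process_kernel_sym:
  assumes "centred_gaussian_process M \<Omega> k h" "p \<in> \<Omega>" "q \<in> \<Omega>"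
  shows "k p q = k q p"
proof -
  have "k p q = integral\<^sup>L M (\<lambda>\<omega>. h p \<omega> * h q \<omega>)" "k q p = integral\<^sup>L M (\<lambda>\<omega>. h q \<omega> * h p \<omega>)"
    using assms by (simp_all add: centred_gaussian_process_def)
  then show ?thesis by (simp add: mult.commute)
qed

text \<open>The double sum is the second moment of the combination of the \<open>h (p i)\<close>
  with coefficients \<open>a i\<close>. A family of points, rather than a set, admits repeated
  design points.\<close>

lemma centred_gaussian_process_kernel_psd:
  fixes a :: "'i \<Rightarrow> real"
  assumes process: "centred_gaussian_process M \<Omega> k h"
    and p: "\<And>i. i \<in> I \<Longrightarrow> p i \<in> \<Omega>"
  shows "0 \<le> (\<Sum>i\<in>I. \<Sum>j\<in>I. a i * a j * k (p i) (p j))"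
proof -
  have "0 \<le> integral\<^sup>L M (\<lambda>\<omega>. (\<Sum>i\<in>I. a i * h (p i) \<omega>)\<^sup>2)"
    by (intro integral_nonneg_AE) simp
  also have "(\<lambda>\<omega>. (\<Sum>i\<in>I. a i * h (p i) \<omega>)\<^sup>2)
      = (\<lambda>\<omega>. \<Sum>i\<in>I. \<Sum>j\<in>I. a i * a j * (h (p i) \<omega> * h (p j) \<omega>))"
    by (simp add: power2_eq_square sum_product mult_ac)
  also have "integral\<^sup>L M \<dots>
      = (\<Sum>i\<in>I. \<Sum>j\<in>I. a i * a j * integral\<^sup>L M (\<lambda>\<omega>. h (p i) \<omega> * h (p j) \<omega>))"
    using process p
    by (simp add: Bochner_Integration.integral_sum integrable_mult_right
        centred_gaussian_process_integrable_mult)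
  also have "\<dots> = (\<Sum>i\<in>I. \<Sum>j\<in>I. a i * a j * k (p i) (p j))"
    using process p by (simp add: centred_gaussian_process_def)
  finally show ?thesis .
qed

section \<open>The noisy Gram matrix and the predictive standard deviation\<close>

lemma noisy_gram_carrier: "noisy_gram k \<tau> m X \<in> carrier_mat m m"
  by (simp add: noisy_gram_def)

text \<open>Separating the kernel part from the noise part serves twice: to invert the matrix and to
  bound the predictive variance.\<close>

lemma noisy_gram_quadratic_form:
  assumes v: "v \<in> carrier_vec m"
  shows "scalar_prod v (noisy_gram k \<tau> m X *\<^sub>v v) =
      (\<Sum>i<m. \<Sum>j<m. vec_index v i * vec_index v j * k (X (Suc i)) (X (Suc j)))
      + (\<Sum>i<m. (\<tau> (Suc i))\<^sup>2 * (vec_index v i)\<^sup>2)"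
proof -
  have row: "vec_index (noisy_gram k \<tau> m X *\<^sub>v v) i
      = (\<Sum>j<m. k (X (Suc i)) (X (Suc j)) * vec_index v j) + (\<tau> (Suc i))\<^sup>2 * vec_index v i"
    if i: "i < m" for i
  proof -
    have "vec_index (noisy_gram k \<tau> m X *\<^sub>v v) i
      = (\<Sum>j<m. (k (X (Suc i)) (X (Suc j)) + (if i = j then (\<tau> (Suc i))\<^sup>2 else 0)) * vec_index v j)"
      using i v by (simp add: noisy_gram_def scalar_prod_def atLeast0LessThan cong: sum.cong_simp)
    also have "\<dots> = (\<Sum>j<m. k (X (Suc i)) (X (Suc j)) * vec_index v j
        + (if i = j then (\<tau> (Suc i))\<^sup>2 * vec_index v j else 0))"
      by (intro sum.cong) (auto simp: algebra_simps)
    also have "\<dots> = (\<Sum>j<m. k (X (Suc i)) (X (Suc j)) * vec_index v j) + (\<tau> (Suc i))\<^sup>2 * vec_index v i"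
      using i by (simp add: sum.distrib)
    finally show ?thesis .
  qed
  have "scalar_prod v (noisy_gram k \<tau> m X *\<^sub>v v)
      = (\<Sum>i<m. vec_index v i * vec_index (noisy_gram k \<tau> m X *\<^sub>v v) i)"
    by (simp add: scalar_prod_def noisy_gram_def atLeast0LessThan)
  also have "\<dots> = (\<Sum>i<m. vec_index v i * ((\<Sum>j<m. k (X (Suc i)) (X (Suc j)) * vec_index v j)
      + (\<tau> (Suc i))\<^sup>2 * vec_index v i))"
    by (intro sum.cong) (auto simp: row)
  also have "\<dots> = (\<Sum>i<m. \<Sum>j<m. vec_index v i * vec_index v j * k (X (Suc i)) (X (Suc j)))
      + (\<Sum>i<m. (\<tau> (Suc i))\<^sup>2 * (vec_index v i)\<^sup>2)"
    by (simp add: sum.distrib sum_distrib_left distrib_left power2_eq_square mult_ac)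
  finally show ?thesis .
qed

text \<open>This gives meaning to \<open>the (mat_inverse ...)\<close> in the predictor. For
  \<open>v\<close> in the null space both nonnegative parts of the quadratic form vanish, and
  positive noise then forces \<open>v = 0\<close>.\<close>

lemma noisy_gram_inverse:
  assumes process: "centred_gaussian_process M \<Omega> k h"
    and X: "\<And>i. i \<in> {1..m} \<Longrightarrow> X i \<in> \<Omega>"
    and \<tau>: "\<And>i. i \<in> {1..m} \<Longrightarrow> 0 < \<tau> i"
  obtains B where "mat_inverse (noisy_gram k \<tau> m X) = Some B"
    and "noisy_gram k \<tau> m X * B = 1\<^sub>m m" and "B \<in> carrier_mat m m"
proof -
  have "v = 0\<^sub>v m" if v: "v \<in> carrier_vec m" and Kv: "noisy_gram k \<tau> m X *\<^sub>v v = 0\<^sub>v m" for v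
  proof -
    have "0 = (\<Sum>i<m. \<Sum>j<m. vec_index v i * vec_index v j * k (X (Suc i)) (X (Suc j)))
      + (\<Sum>i<m. (\<tau> (Suc i))\<^sup>2 * (vec_index v i)\<^sup>2)"
      using noisy_gram_quadratic_form[OF v, of k \<tau> X] v by (simp add: Kv)
    moreover have "0 \<le> (\<Sum>i<m. \<Sum>j<m. vec_index v i * vec_index v j * k (X (Suc i)) (X (Suc j)))"
      by (rule centred_gaussian_process_kernel_psd[OF process]) (auto intro: X)
    moreover have "0 \<le> (\<Sum>i<m. (\<tau> (Suc i))\<^sup>2 * (vec_index v i)\<^sup>2)"
      by (intro sum_nonneg) simp
    ultimately have "(\<Sum>i<m. (\<tau> (Suc i))\<^sup>2 * (vec_index v i)\<^sup>2) = 0"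
      by linarith
    then have "\<forall>i<m. (\<tau> (Suc i))\<^sup>2 * (vec_index v i)\<^sup>2 = 0"
      by (subst (asm) sum_nonneg_eq_0_iff) auto
    then have "vec_index v i = 0" if "i < m" for i
      using that \<tau>[of "Suc i"] by fastforce
    then show ?thesis using v by (intro eq_vecI) auto
  qed
  then have "det (noisy_gram k \<tau> m X) \<noteq> 0"
    unfolding det_0_iff_vec_prod_zero[OF noisy_gram_carrier] by blast
  then have "noisy_gram k \<tau> m X \<in> Units (ring_mat TYPE(real) m ())"
    by (rule det_non_zero_imp_unit[OF noisy_gram_carrier])
  then obtain B where "mat_inverse (noisy_gram k \<tau> m X) = Some B"
    using mat_inverse(1)[OF noisy_gram_carrier, where b = "()"] by (cases "mat_inverse (noisy_gram k \<tau> m X)") auto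
  with mat_inverse(2)[OF noisy_gram_carrier this] that show thesis by blast
qed

text \<open>\<^const>\<open>sqrt\<close> of a negative number is negative, so this is where positive semidefiniteness of
  the kernel enters. With \<open>v = K\<^sup>-\<^sup>1 c\<close> one has \<open>c\<^sup>T v = v\<^sup>T K v\<close>, so that \<open>k x x - c\<^sup>T v\<close>
  is the second moment of \<open>h x - (\<Sum>i. v\<^sub>i h (X i))\<close> plus \<open>\<Sum>i. \<tau>\<^sub>i\<^sup>2 v\<^sub>i\<^sup>2\<close>.\<close>

lemma gp_sd_nonneg:
  assumes process: "centred_gaussian_process M \<Omega> k h"
    and X: "\<And>i. i \<in> {1..m} \<Longrightarrow> X i \<in> \<Omega>"
    and \<tau>: "\<And>i. i \<in> {1..m} \<Longrightarrow> 0 < \<tau> i"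
    and x: "x \<in> \<Omega>"
  shows "0 \<le> gp_sd k \<tau> m X x"
proof -
  define K where "K = noisy_gram k \<tau> m X"
  define c where "c = cross_cov k m X x"
  obtain B where B: "mat_inverse K = Some B" "K * B = 1\<^sub>m m" "B \<in> carrier_mat m m"
    using noisy_gram_inverse[of M \<Omega> k h m X \<tau>] process X \<tau> unfolding K_def by blast
  have K: "K \<in> carrier_mat m m" unfolding K_def by (rule noisy_gram_carrier)
  have c: "c \<in> carrier_vec m" by (simp add: c_def cross_cov_def)
  define v where "v = B *\<^sub>v c"
  have v: "v \<in> carrier_vec m" using B(3) c by (auto simp: v_def)
  have "K *\<^sub>v v = c"
    using B K c unfolding v_def by (metis assoc_mult_mat_vec one_mult_mat_vec)
  then have vc: "scalar_prod v c =
      (\<Sum>i<m. \<Sum>j<m. vec_index v i * vec_index v j * k (X (Suc i)) (X (Suc j)))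
      + (\<Sum>i<m. (\<tau> (Suc i))\<^sup>2 * (vec_index v i)\<^sup>2)"
    using noisy_gram_quadratic_form[OF v, of k \<tau> X] by (simp add: K_def)
  \<comment> \<open>Index 0 carries the prediction point with coefficient 1; index
    \<open>Suc i\<close> carries the design point \<open>X (Suc i)\<close> with minus entry
    \<open>i\<close> of \<open>v\<close>.\<close>
  define p where "p i = (if i = 0 then x else X i)" for i
  define a where "a i = (if i = 0 then 1 else - vec_index v (i - 1))" for i
  have cross: "(\<Sum>i<m. vec_index v i * k (X (Suc i)) x) = scalar_prod v c"
    by (simp add: scalar_prod_def c_def cross_cov_def atLeast0LessThan)
  \<comment> \<open>Splitting off index 0 leaves cross terms in both argument orders; symmetry of
    the kernel identifies them.\<close>
  have cross': "(\<Sum>i<m. vec_index v i * k x (X (Suc i))) = scalar_prod v c"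
    unfolding cross[symmetric]
    by (intro sum.cong) (auto simp: centred_gaussian_process_kernel_sym[OF process x] X)
  have "0 \<le> (\<Sum>i<Suc m. \<Sum>j<Suc m. a i * a j * k (p i) (p j))"
    by (rule centred_gaussian_process_kernel_psd[OF process]) (auto simp: p_def x intro: X)
  also have "\<dots> = k x x - scalar_prod v c - scalar_prod v c
      + (\<Sum>i<m. \<Sum>j<m. vec_index v i * vec_index v j * k (X (Suc i)) (X (Suc j)))"
    unfolding sum.lessThan_Suc_shift
    by (simp add: a_def p_def sum.distrib sum_negf sum_subtractf cross cross')
  \<comment> \<open>By \<open>vc\<close> the kernel double sum is \<open>scalar_prod v c\<close>
    minus the noise sum, which cancels one of the two cross terms.\<close>
  finally have "scalar_prod v c \<le> k x x
      - (\<Sum>i<m. (\<tau> (Suc i))\<^sup>2 * (vec_index v i)\<^sup>2)"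
    using vc by linarith
  moreover have "0 \<le> (\<Sum>i<m. (\<tau> (Suc i))\<^sup>2 * (vec_index v i)\<^sup>2)"
    by (intro sum_nonneg) simp
  moreover have "scalar_prod c v = scalar_prod v c"
    by (rule comm_scalar_prod[OF c v])
  ultimately show ?thesis
    by (simp add: gp_sd_def B(1) flip: K_def c_def v_def)
qed

section \<open>Conditioning on the data\<close>

lemma data_algebra_subalgebra:
  assumes "\<And>j. j \<in> {1..m} \<Longrightarrow> x j \<in> borel_measurable M"
    and "\<And>j. j \<in> {1..m} \<Longrightarrow> y j \<in> borel_measurable M"
  shows "subalgebra M (data_algebra M x y m)"
proof -
  have "(\<lambda>\<omega>. \<lambda>j\<in>{1..m}. (x j \<omega>, y j \<omega>))
      \<in> M \<rightarrow>\<^sub>M (\<Pi>\<^sub>M j\<in>{1..m}. borel \<Otimes>\<^sub>M borel)"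
    by (intro measurable_restrict measurable_Pair assms)
  from sets_image_in_sets[OF refl this] show ?thesis
    by (simp add: subalgebra_def data_algebra_def)
qed

text \<open>The tail bound does not depend on the outcome, so it survives integrating the
  conditional probability, whose integral is the unconditional one.\<close>

lemma (in prob_space) conditionally_gaussian_prob_ge:
  assumes sub: "subalgebra M F"
    and Z [measurable]: "Z \<in> borel_measurable M"
    and law: "conditionally_gaussian M F Z \<mu> \<sigma>"
    and safe: "AE \<omega> in M. 0 \<le> \<sigma> \<omega> \<and> \<mu> \<omega> + \<beta> * \<sigma> \<omega> < \<xi>"
  shows "prob {\<omega> \<in> space M. Z \<omega> \<ge> \<xi>} \<le> 1 - std_normal_cdf \<beta>"
proof -
  define A where "A = Z -` {\<xi>..} \<inter> space M"
  have A: "A \<in> events" unfolding A_def by measurable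
  interpret finite_measure_subalgebra M F
    using sub by unfold_locales
  have int: "integrable M (indicator A :: _ \<Rightarrow> real)"
    using A by (intro integrable_real_indicator) (simp_all add: emeasure_eq_measure)
  have "{\<omega> \<in> space M. Z \<omega> \<ge> \<xi>} = A" by (auto simp: A_def)
  then have "prob {\<omega> \<in> space M. Z \<omega> \<ge> \<xi>} = integral\<^sup>L M (indicator A)"
    using A by simp
  also have "\<dots> = integral\<^sup>L M (real_cond_exp M F (indicator A))"
    by (rule real_cond_exp_int(2)[OF int, symmetric])
  also have "\<dots> \<le> integral\<^sup>L M (\<lambda>_. 1 - std_normal_cdf \<beta>)"
  proof (rule integral_mono_AE[OF real_cond_exp_int(1)[OF int]])
    have "AE \<omega> in M. real_cond_exp M F (indicator A) \<omega>
        = measure (gaussian_measure (\<mu> \<omega>) (\<sigma> \<omega>)) {\<xi>..}"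
      using law unfolding conditionally_gaussian_def A_def by simp
    with safe show "AE \<omega> in M. real_cond_exp M F (indicator A) \<omega> \<le> 1 - std_normal_cdf \<beta>"
      by eventually_elim (simp add: gaussian_tail_le)
  qed simp
  also have "\<dots> = 1 - std_normal_cdf \<beta>"
    by (simp add: prob_space)
  finally show ?thesis .
qed

lemma (in gp_observations) observation_measurable:
  assumes "j \<in> {1..T}"
  shows "y j \<in> borel_measurable M"
proof -
  have "\<epsilon> j \<in> borel_measurable M"
    using noise_indep assms by (simp add: indep_vars_def)
  then have "(\<lambda>\<omega>. h (x j \<omega>) \<omega> + \<epsilon> j \<omega>) \<in> borel_measurable M"
    by (intro borel_measurable_add value_measurable assms)
  then show ?thesis
    by (rule measurable_cong[THEN iffD2, rotated]) (rule observation[OF assms])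
qed

theorem theorem1:
  fixes M :: "'s measure"
    and \<Omega> :: "(real ^ 'd) set"
    and k :: "real ^ 'd \<Rightarrow> real ^ 'd \<Rightarrow> real"
    and h :: "real ^ 'd \<Rightarrow> 's \<Rightarrow> real"
    and \<tau> :: "nat \<Rightarrow> real"
    and \<epsilon> :: "nat \<Rightarrow> 's \<Rightarrow> real"
    and x :: "nat \<Rightarrow> 's \<Rightarrow> real ^ 'd"
    and y :: "nat \<Rightarrow> 's \<Rightarrow> real"
    and \<xi> \<gamma> \<beta> :: real
    and n N :: nat
  assumes "gp_observations M (n + N) \<Omega> k h \<tau> \<epsilon> x y"
    and "N \<ge> 1"
    and "0 < \<gamma>" "\<gamma> < 1"
    and "\<beta> = inv_into UNIV std_normal_cdf (1 - \<gamma> / real N)"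
    and chosen_from_data:
      "\<And>i. i \<in> {n+1..n+N} \<Longrightarrow> x i \<in> data_algebra M x y (i - 1) \<rightarrow>\<^sub>M borel"
    and conditional_law:
      "\<And>i. i \<in> {n+1..n+N} \<Longrightarrow>
         conditionally_gaussian M (data_algebra M x y (i - 1)) (\<lambda>\<omega>. h (x i \<omega>) \<omega>)
           (\<lambda>\<omega>. gp_mean k \<tau> (i - 1) (\<lambda>j. x j \<omega>) (\<lambda>j. y j \<omega>) (x i \<omega>))
           (\<lambda>\<omega>. gp_sd k \<tau> (i - 1) (\<lambda>j. x j \<omega>) (x i \<omega>))"
    and chosen_safe:
      "\<And>i. i \<in> {n+1..n+N} \<Longrightarrow>
         AE \<omega> in M. x i \<omega> \<in> safe_region \<Omega> \<xi> \<beta> k \<tau> (i - 1) (\<lambda>j. x j \<omega>) (\<lambda>j. y j \<omega>)"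
  shows "measure M (\<Union>i\<in>{n+1..n+N}. {\<omega> \<in> space M. h (x i \<omega>) \<omega> \<ge> \<xi>}) \<le> \<gamma>"
proof -
  interpret gp_observations M "n + N" \<Omega> k h \<tau> \<epsilon> x y by fact
  define E where "E i = {\<omega> \<in> space M. h (x i \<omega>) \<omega> \<ge> \<xi>}" for i
  \<comment> \<open>This puts the level \<open>1 - \<gamma> / real N\<close> strictly between 0 and
    1, where the quantile is genuine.\<close>
  have "\<gamma> / real N < 1"
    using assms(2,4) by (simp add: divide_less_eq)
  then have \<beta>: "1 - std_normal_cdf \<beta> = \<gamma> / real N"
    using assms(2,3) by (simp add: assms(5) std_normal_cdf_inv_into)
  have E: "E i \<in> events \<and> prob (E i) \<le> \<gamma> / real N" if i: "i \<in> {n+1..n+N}" for i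
  proof -
    \<comment> \<open>The predictor for query \<open>i\<close> uses points 1 to
      \<open>i - 1\<close>, including the initial \<open>n\<close>; all lie within the horizon
      \<open>n + N\<close> of the locale.\<close>
    have iT: "i \<in> {1..n+N}" and le: "\<And>j. j \<in> {1..i - 1} \<Longrightarrow> j \<in> {1..n+N}"
      using i by auto
    have Z [measurable]: "(\<lambda>\<omega>. h (x i \<omega>) \<omega>) \<in> borel_measurable M"
      using iT by (rule value_measurable)
    have sub: "subalgebra M (data_algebra M x y (i - 1))"
      by (rule data_algebra_subalgebra) (use le design_measurable observation_measurable in blast)+
    \<comment> \<open>Safety holds almost everywhere, while nonnegativity of \<open>gp_sd\<close>
      holds at every outcome of the space, where the design points lie in \<Omega>.\<close>
    have "AE \<omega> in M. 0 \<le> gp_sd k \<tau> (i - 1) (\<lambda>j. x j \<omega>) (x i \<omega>) \<and>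
        gp_mean k \<tau> (i - 1) (\<lambda>j. x j \<omega>) (\<lambda>j. y j \<omega>) (x i \<omega>)
          + \<beta> * gp_sd k \<tau> (i - 1) (\<lambda>j. x j \<omega>) (x i \<omega>) < \<xi>"
      using chosen_safe[OF i] AE_space
    proof eventually_elim
      case (elim \<omega>)
      then show ?case
        by (auto simp: safe_region_def
            intro!: gp_sd_nonneg[OF process] design_in_domain noise_sd_pos le iT)
    qed
    from conditionally_gaussian_prob_ge[OF sub Z conditional_law[OF i] this]
    show ?thesis unfolding E_def \<beta> by simp
  qed
  \<comment> \<open>The union bound asks for no independence between the failures, and its
    \<open>N\<close> equal terms add up to \<gamma>.\<close>
  have "prob (\<Union>i\<in>{n+1..n+N}. E i) \<le> (\<Sum>i\<in>{n+1..n+N}. prob (E i))"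
    using E by (intro finite_measure_subadditive_finite) auto
  also have "\<dots> \<le> (\<Sum>i\<in>{n+1..n+N}. \<gamma> / real N)"
    using E by (intro sum_mono) blast
  also have "\<dots> = \<gamma>"
    using assms(2) by simp
  finally show ?thesis unfolding E_def .
qed

end
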